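(* Let $A$ be an MV-algebra and let $I\neq\{0\}$ be a proper ideal of $A$ with $|A/I|\ge 3$. Then $$\mathrm{gr}(\Gamma_I(A))=\begin{cases}\infty, & \text{if } A\cong L_2\times L_3 \text{ via an isomorphism mapping } I \text{ onto } L_2\times\{0\};\\ 4, & \text{if } A/I\cong B_4;\\ 3, & \text{otherwise.}\end{cases}$$
   Context: An MV-algebra is an algebra $(A,\oplus,*,0)$ of type $(2,1,0)$ such that $(A,\oplus,0)$ is a commutative monoid, $x^{**}=x$, $x\oplus 0^*=0^*$, and $(x^*\oplus y)^*\oplus y=(y^*\oplus x)^*\oplus x$ for all $x,y$. Put $1=0^*$, $x\odot y=(x^*\oplus y^* )^*$, and $x\le y$ iff $x^*\oplus y=1$ (a partial order). The direct product of MV-algebras has pointwise operations. An ideal of $A$ is a subset $I\subseteq A$ with $0\in I$; $a,b\in I$ implies $a\oplus b\in I$; and $b\in I$, $a\le b$ implies $a\in I$. It is proper if $I\ne A$. With $d(x,y)=(x\odot y^* )\oplus(y\odot x^* )$, the relation $x\equiv_I y\iff d(x,y)\in I$ is a congruence and $A/I$ is the corresponding quotient MV-algebra. For $n\ge 2$, $L_n=\{0,\frac1{n-1},\dots,\frac{n-2}{n-1},1\}$ is the MV-algebra with $x\oplus y=\min\{1,x+y\}$, $x^*=1-x$. $B_4$ is the 4-element Boolean algebra regarded as an MV-algebra ($\oplus$ is join, $*$ is complement). For a proper ideal $I$, $\Gamma_I(A)$ is the simple graph with vertex set $\{x\in A\setminus I : \exists y\in A\setminus I,\ x\odot y\in I\}$,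 in which distinct vertices $x,y$ are adjacent iff $x\odot y\in I$. The girth $\mathrm{gr}$ of a graph is the length of a shortest cycle (cycles have at least three vertices), and is $\infty$ if there is no cycle. *)

theory Defs
  imports Complex_Main "HOL-Algebra.Congruence" "HOL-Library.Extended_Nat"
begin

record 'a mv = "'a partial_object" +
  mv_plus :: "'a \<Rightarrow> 'a \<Rightarrow> 'a" (infixl \<open>\<oplus>\<index>\<close> 65)
  mv_neg :: "'a \<Rightarrow> 'a" (\<open>\<sim>\<index> _\<close> [81] 80)
  mv_zero :: 'a (\<open>\<zero>\<index>\<close>)

definition mv_one :: "('a, 'm) mv_scheme \<Rightarrow> 'a" (\<open>\<one>\<index>\<close>) where
  "\<one>\<^bsub>A\<^esub> = \<sim>\<^bsub>A\<^esub> \<zero>\<^bsub>A\<^esub>"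

definition mv_times :: "('a, 'm) mv_scheme \<Rightarrow> 'a \<Rightarrow> 'a \<Rightarrow> 'a" (infixl \<open>\<odot>\<index>\<close> 70) where
  "x \<odot>\<^bsub>A\<^esub> y = \<sim>\<^bsub>A\<^esub> (\<sim>\<^bsub>A\<^esub> x \<oplus>\<^bsub>A\<^esub> \<sim>\<^bsub>A\<^esub> y)"

definition mv_le :: "('a, 'm) mv_scheme \<Rightarrow> 'a \<Rightarrow> 'a \<Rightarrow> bool" (infix \<open>\<sqsubseteq>\<index>\<close> 50) where
  "x \<sqsubseteq>\<^bsub>A\<^esub> y \<longleftrightarrow> \<sim>\<^bsub>A\<^esub> x \<oplus>\<^bsub>A\<^esub> y = \<one>\<^bsub>A\<^esub>"

definition mv_dist :: "('a, 'm) mv_scheme \<Rightarrow> 'a \<Rightarrow> 'a \<Rightarrow> 'a" where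
  "mv_dist A x y = (x \<odot>\<^bsub>A\<^esub> \<sim>\<^bsub>A\<^esub> y) \<oplus>\<^bsub>A\<^esub> (y \<odot>\<^bsub>A\<^esub> \<sim>\<^bsub>A\<^esub> x)"

locale mv_algebra =
  fixes A :: "('a, 'm) mv_scheme" (structure)
  assumes plus_closed: "\<lbrakk>x \<in> carrier A; y \<in> carrier A\<rbrakk> \<Longrightarrow> x \<oplus> y \<in> carrier A"
    and neg_closed: "x \<in> carrier A \<Longrightarrow> \<sim> x \<in> carrier A"
    and zero_closed: "\<zero> \<in> carrier A"
    and plus_assoc: "\<lbrakk>x \<in> carrier A; y \<in> carrier A; z \<in> carrier A\<rbrakk>
          \<Longrightarrow> (x \<oplus> y) \<oplus> z = x \<oplus> (y \<oplus> z)"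
    and plus_commute: "\<lbrakk>x \<in> carrier A; y \<in> carrier A\<rbrakk> \<Longrightarrow> x \<oplus> y = y \<oplus> x"
    and plus_zero: "x \<in> carrier A \<Longrightarrow> x \<oplus> \<zero> = x"
    and neg_neg: "x \<in> carrier A \<Longrightarrow> \<sim> (\<sim> x) = x"
    and plus_neg_zero: "x \<in> carrier A \<Longrightarrow> x \<oplus> \<sim> \<zero> = \<sim> \<zero>"
    and lukasiewicz: "\<lbrakk>x \<in> carrier A; y \<in> carrier A\<rbrakk>
          \<Longrightarrow> \<sim> (\<sim> x \<oplus> y) \<oplus> y = \<sim> (\<sim> y \<oplus> x) \<oplus> x"

definition mv_iso :: "('a, 'm) mv_scheme \<Rightarrow> ('b, 'n) mv_scheme \<Rightarrow> ('a \<Rightarrow> 'b) set" where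
  "mv_iso A B = {h. bij_betw h (carrier A) (carrier B) \<and>
     (\<forall>x \<in> carrier A. \<forall>y \<in> carrier A. h (x \<oplus>\<^bsub>A\<^esub> y) = h x \<oplus>\<^bsub>B\<^esub> h y) \<and>
     (\<forall>x \<in> carrier A. h (\<sim>\<^bsub>A\<^esub> x) = \<sim>\<^bsub>B\<^esub> (h x)) \<and>
     h \<zero>\<^bsub>A\<^esub> = \<zero>\<^bsub>B\<^esub>}"

definition mv_isomorphic :: "('a, 'm) mv_scheme \<Rightarrow> ('b, 'n) mv_scheme \<Rightarrow> bool"
    (infix \<open>\<cong>\<^sub>m\<^sub>v\<close> 50) where
  "A \<cong>\<^sub>m\<^sub>v B \<longleftrightarrow> mv_iso A B \<noteq> {}"

definition mv_prod :: "('a, 'm) mv_scheme \<Rightarrow> ('b, 'n) mv_scheme \<Rightarrow> ('a \<times> 'b) mv"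
    (infixr \<open>\<times>\<^sub>m\<^sub>v\<close> 80) where
  "A \<times>\<^sub>m\<^sub>v B = \<lparr>carrier = carrier A \<times> carrier B,
     mv_plus = (\<lambda>p q. (fst p \<oplus>\<^bsub>A\<^esub> fst q, snd p \<oplus>\<^bsub>B\<^esub> snd q)),
     mv_neg = (\<lambda>p. (\<sim>\<^bsub>A\<^esub> (fst p), \<sim>\<^bsub>B\<^esub> (snd p))),
     mv_zero = (\<zero>\<^bsub>A\<^esub>, \<zero>\<^bsub>B\<^esub>)\<rparr>"

definition mv_ideal :: "'a set \<Rightarrow> ('a, 'm) mv_scheme \<Rightarrow> bool" where
  "mv_ideal I A \<longleftrightarrow> I \<subseteq> carrier A \<and> \<zero>\<^bsub>A\<^esub> \<in> I \<and>
     (\<forall>a \<in> I. \<forall>b \<in> I. a \<oplus>\<^bsub>A\<^esub> b \<in> I) \<and>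
     (\<forall>a \<in> carrier A. \<forall>b \<in> I. a \<sqsubseteq>\<^bsub>A\<^esub> b \<longrightarrow> a \<in> I)"

definition mv_proper_ideal :: "'a set \<Rightarrow> ('a, 'm) mv_scheme \<Rightarrow> bool" where
  "mv_proper_ideal I A \<longleftrightarrow> mv_ideal I A \<and> I \<noteq> carrier A"

definition mv_cong :: "('a, 'm) mv_scheme \<Rightarrow> 'a set \<Rightarrow> ('a \<times> 'a) set" where
  "mv_cong A I = {(x, y) \<in> carrier A \<times> carrier A. mv_dist A x y \<in> I}"

text \<open>
  The operations on classes are written representative-free: since \<^const>\<open>mv_cong\<close> is a
  congruence when \<open>I\<close> is an ideal, each union below is a union of copies of one and the same class.
\<close>

definition mv_quot :: "('a, 'm) mv_scheme \<Rightarrow> 'a set \<Rightarrow> 'a set mv" (infixl \<open>'/\<^sub>m\<^sub>v\<close> 75) where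
  "A /\<^sub>m\<^sub>v I = \<lparr>carrier = carrier A // mv_cong A I,
     mv_plus = (\<lambda>X Y. \<Union>x \<in> X. \<Union>y \<in> Y. mv_cong A I `` {x \<oplus>\<^bsub>A\<^esub> y}),
     mv_neg = (\<lambda>X. \<Union>x \<in> X. mv_cong A I `` {\<sim>\<^bsub>A\<^esub> x}),
     mv_zero = mv_cong A I `` {\<zero>\<^bsub>A\<^esub>}\<rparr>"

text \<open>Meaningful only for \<open>n \<ge> 2\<close>.\<close>

definition mv_chain :: "nat \<Rightarrow> real mv" where
  "mv_chain n = \<lparr>carrier = {real k / (real n - 1) | k. k < n},
     mv_plus = (\<lambda>x y. min 1 (x + y)),
     mv_neg = (\<lambda>x. 1 - x),
     mv_zero = 0\<rparr>"

definition boolean_mv :: "'a :: boolean_algebra mv" where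
  "boolean_mv = \<lparr>carrier = UNIV, mv_plus = sup, mv_neg = uminus, mv_zero = bot\<rparr>"

text \<open>The four-element Boolean algebra is taken to be the powerset algebra of a two-element type.\<close>

definition mv_B4 :: "bool set mv" where
  "mv_B4 = boolean_mv"

record 'a simple_graph =
  vertices :: "'a set"
  edges :: "'a set set"

text \<open>A cycle is given by its list of vertices, the first vertex not being repeated at the end.\<close>

definition is_cycle :: "('a, 'm) simple_graph_scheme \<Rightarrow> 'a list \<Rightarrow> bool" where
  "is_cycle G c \<longleftrightarrow> 3 \<le> length c \<and> distinct c \<and> set c \<subseteq> vertices G \<and>
     (\<forall>i < length c. {c ! i, c ! (Suc i mod length c)} \<in> edges G)"

text \<open>For an acyclic graph this is the infimum of the empty set, i.e.\ \<open>\<infinity>\<close>.\<close>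

definition girth :: "('a, 'm) simple_graph_scheme \<Rightarrow> enat" where
  "girth G = (INF c \<in> {c. is_cycle G c}. enat (length c))"

definition ideal_graph_vertices :: "('a, 'm) mv_scheme \<Rightarrow> 'a set \<Rightarrow> 'a set" where
  "ideal_graph_vertices A I = {x \<in> carrier A - I. \<exists>y \<in> carrier A - I. x \<odot>\<^bsub>A\<^esub> y \<in> I}"

definition ideal_graph :: "'a set \<Rightarrow> ('a, 'm) mv_scheme \<Rightarrow> 'a simple_graph" where
  "ideal_graph I A = \<lparr>vertices = ideal_graph_vertices A I,
     edges = {{x, y} | x y. x \<in> ideal_graph_vertices A I \<and> y \<in> ideal_graph_vertices A I \<and>
                x \<noteq> y \<and> x \<odot>\<^bsub>A\<^esub> y \<in> I}\<rparr>"

end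

theory Submission
  imports Defs
begin

text \<open>
  Everything is computed in \<open>A\<close> with the preorder \<open>x \<lesssim> y \<longleftrightarrow> x \<odot> \<sim> y \<in> I\<close>, so that
  \<open>x \<odot> y \<in> I\<close> means \<open>x \<lesssim> \<sim> y\<close>. Since \<open>I \<noteq> {0}\<close>, every class modulo \<open>I\<close> has at least two
  elements. If some \<open>x \<notin> I\<close> has \<open>x \<odot> x \<in> I\<close>, the class of \<open>x\<close> is a clique, and two of its elements
  form a triangle with any neighbour of \<open>x\<close> outside the class. If there is no such neighbour,
  \<open>A/I\<close> is the three-element chain, and the class of \<open>x\<close> contains a triangle unless it has exactly two
  elements, which forces \<open>A\<close> to have six elements and to be \<open>L\<^sub>2 \<times> L\<^sub>3\<close>. If there is no such \<open>x\<close>,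
  then \<open>A/I\<close> is Boolean: either it is \<open>B\<^sub>4\<close> and the graph is complete bipartite between two classes with
  at least two elements each, or it has three pairwise disjoint nonzero elements.
\<close>

section \<open>Arithmetic in an MV-algebra\<close>

context mv_algebra
begin

lemma one_closed [simp]: "\<one> \<in> carrier A"
  by (simp add: mv_one_def neg_closed zero_closed)

lemmas [simp] = plus_closed neg_closed zero_closed plus_zero neg_neg

lemma neg_zero [simp]: "\<sim> \<zero> = \<one>"
  by (simp add: mv_one_def)

lemma neg_one [simp]: "\<sim> \<one> = \<zero>"
  using neg_neg[OF zero_closed] by simp

lemma zero_plus [simp]: "x \<in> carrier A \<Longrightarrow> \<zero> \<oplus> x = x"
  by (simp add: plus_commute[of "\<zero>"])

lemma plus_one [simp]: "x \<in> carrier A \<Longrightarrow> x \<oplus> \<one> = \<one>"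
  using plus_neg_zero by simp

lemma one_plus [simp]: "x \<in> carrier A \<Longrightarrow> \<one> \<oplus> x = \<one>"
  by (simp add: plus_commute[of "\<one>"])

lemma plus_left_commute:
  "\<lbrakk>x \<in> carrier A; y \<in> carrier A; z \<in> carrier A\<rbrakk> \<Longrightarrow> x \<oplus> (y \<oplus> z) = y \<oplus> (x \<oplus> z)"
  by (metis plus_assoc plus_commute)

lemmas plus_ac = plus_assoc plus_commute plus_left_commute

text \<open>Put \<open>y = \<one>\<close> in the Lukasiewicz axiom: the left side collapses to
  \<open>\<one>\<close>, the right side to \<open>\<sim> x \<oplus> x\<close>.\<close>

lemma neg_plus_self [simp]: "x \<in> carrier A \<Longrightarrow> \<sim> x \<oplus> x = \<one>"
  using lukasiewicz[of x "\<one>"] by simp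

lemma plus_neg_self [simp]: "x \<in> carrier A \<Longrightarrow> x \<oplus> \<sim> x = \<one>"
  using neg_plus_self[of x] by (simp add: plus_commute)

lemma times_closed [simp]: "\<lbrakk>x \<in> carrier A; y \<in> carrier A\<rbrakk> \<Longrightarrow> x \<odot> y \<in> carrier A"
  by (simp add: mv_times_def)

lemma times_commute: "\<lbrakk>x \<in> carrier A; y \<in> carrier A\<rbrakk> \<Longrightarrow> x \<odot> y = y \<odot> x"
  by (simp add: mv_times_def plus_commute)

lemma times_assoc:
  "\<lbrakk>x \<in> carrier A; y \<in> carrier A; z \<in> carrier A\<rbrakk> \<Longrightarrow> x \<odot> y \<odot> z = x \<odot> (y \<odot> z)"
  by (simp add: mv_times_def plus_assoc)

lemma times_neg_self [simp]: "x \<in> carrier A \<Longrightarrow> x \<odot> \<sim> x = \<zero>"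
  by (simp add: mv_times_def)

lemma neg_times_self [simp]: "x \<in> carrier A \<Longrightarrow> \<sim> x \<odot> x = \<zero>"
  by (simp add: mv_times_def)

lemma times_zero [simp]: "x \<in> carrier A \<Longrightarrow> x \<odot> \<zero> = \<zero>"
  by (simp add: mv_times_def)

lemma times_one [simp]: "x \<in> carrier A \<Longrightarrow> x \<odot> \<one> = x"
  by (simp add: mv_times_def)

lemma neg_eq_iff: "\<lbrakk>x \<in> carrier A; y \<in> carrier A\<rbrakk> \<Longrightarrow> \<sim> x = y \<longleftrightarrow> x = \<sim> y"
  by auto

section \<open>The natural order and residuation\<close>

lemma le_refl [simp]: "x \<in> carrier A \<Longrightarrow> x \<sqsubseteq> x"
  by (simp add: mv_le_def)

text \<open>Under the two inequalities the sides of the Lukasiewicz axiom reduce to \<open>y\<close>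
  and \<open>x\<close>.\<close>

lemma le_antisym: "\<lbrakk>x \<in> carrier A; y \<in> carrier A; x \<sqsubseteq> y; y \<sqsubseteq> x\<rbrakk> \<Longrightarrow> x = y"
  using lukasiewicz[of x y] by (simp add: mv_le_def)

lemma le_plus: "\<lbrakk>x \<in> carrier A; y \<in> carrier A\<rbrakk> \<Longrightarrow> x \<sqsubseteq> x \<oplus> y"
  by (simp add: mv_le_def flip: plus_assoc)

text \<open>The witness is the difference \<open>y \<odot> \<sim> x\<close>, and the Lukasiewicz
  axiom gives the equation. Transitivity and monotonicity then become rearrangements of
  sums.\<close>

lemma le_imp_plus:
  assumes "x \<in> carrier A" "y \<in> carrier A" "x \<sqsubseteq> y"
  obtains z where "z \<in> carrier A" "y = x \<oplus> z"
proof
  show "\<sim> (\<sim> y \<oplus> x) \<in> carrier A" using assms by simp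
  show "y = x \<oplus> \<sim> (\<sim> y \<oplus> x)"
    using lukasiewicz[of x y] assms by (simp add: mv_le_def plus_commute)
qed

lemma le_trans:
  assumes "x \<in> carrier A" "y \<in> carrier A" "z \<in> carrier A" "x \<sqsubseteq> y" "y \<sqsubseteq> z"
  shows "x \<sqsubseteq> z"
  by (metis assms le_imp_plus le_plus plus_assoc plus_closed)

lemma plus_mono:
  assumes "x \<in> carrier A" "y \<in> carrier A" "u \<in> carrier A" "v \<in> carrier A" "x \<sqsubseteq> y" "u \<sqsubseteq> v"
  shows "x \<oplus> u \<sqsubseteq> y \<oplus> v"
proof -
  obtain z where z: "z \<in> carrier A" "y = x \<oplus> z" using assms le_imp_plus by blast
  obtain w where w: "w \<in> carrier A" "v = u \<oplus> w" using assms le_imp_plus by blast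
  have "y \<oplus> v = (x \<oplus> u) \<oplus> (z \<oplus> w)" using z w assms by (simp add: plus_ac)
  then show ?thesis using le_plus z w assms by simp
qed

text \<open>Residuation: both inequalities unfold to the same triple sum being
  \<open>\<one>\<close>.\<close>

lemma times_le_iff:
  "\<lbrakk>x \<in> carrier A; y \<in> carrier A; z \<in> carrier A\<rbrakk> \<Longrightarrow> x \<odot> y \<sqsubseteq> z \<longleftrightarrow> x \<sqsubseteq> \<sim> y \<oplus> z"
  by (simp add: mv_times_def mv_le_def plus_assoc)

lemma le_zero_iff: "x \<in> carrier A \<Longrightarrow> x \<sqsubseteq> \<zero> \<longleftrightarrow> x = \<zero>"
  by (auto simp: mv_le_def neg_eq_iff)

lemma le_neg_iff: "\<lbrakk>x \<in> carrier A; y \<in> carrier A\<rbrakk> \<Longrightarrow> x \<sqsubseteq> \<sim> y \<longleftrightarrow> y \<sqsubseteq> \<sim> x"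
  by (simp add: mv_le_def plus_commute)

lemma times_le: "\<lbrakk>x \<in> carrier A; y \<in> carrier A\<rbrakk> \<Longrightarrow> x \<odot> y \<sqsubseteq> x"
  by (simp add: times_le_iff plus_commute le_plus)

text \<open>Both sides are the lattice meet of \<open>x\<close> and \<open>y\<close>.\<close>

lemma meet_commute:
  "\<lbrakk>x \<in> carrier A; y \<in> carrier A\<rbrakk> \<Longrightarrow> x \<odot> (\<sim> x \<oplus> y) = y \<odot> (\<sim> y \<oplus> x)"
  using lukasiewicz[of "\<sim> x" "\<sim> y"] by (simp add: mv_times_def plus_commute)

text \<open>The meet of \<open>i\<close> and \<open>\<sim> x\<close> is computed twice: it is
  \<open>i\<close> because \<open>i\<close> lies below \<open>\<sim> x\<close>, and it is
  \<open>\<sim> x \<odot> (x \<oplus> i) = \<sim> x \<odot> x\<close> because \<open>x\<close>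
  absorbs \<open>i\<close>. This limits how often adding an ideal element can have no
  effect.\<close>

lemma zero_of_absorbed_le_neg:
  assumes "x \<in> carrier A" "i \<in> carrier A" "x \<oplus> i = x" "i \<sqsubseteq> \<sim> x"
  shows "i = \<zero>"
proof -
  have "i = i \<odot> (\<sim> i \<oplus> \<sim> x)" using assms by (simp add: mv_le_def)
  also have "\<dots> = \<sim> x \<odot> (x \<oplus> i)" using meet_commute[of i "\<sim> x"] assms by simp
  also have "\<dots> = \<zero>" using assms by simp
  finally show ?thesis .
qed

end

section \<open>The preorder modulo an ideal\<close>

locale mv_algebra_ideal = mv_algebra +
  fixes I :: "'a set"
  assumes ideal: "mv_ideal I A"
begin

definition below :: "'a \<Rightarrow> 'a \<Rightarrow> bool" (infix \<open>\<lesssim>\<close> 50) where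
  "x \<lesssim> y \<longleftrightarrow> x \<odot> \<sim> y \<in> I"

lemma in_carrier: "x \<in> I \<Longrightarrow> x \<in> carrier A"
  using ideal by (auto simp: mv_ideal_def)

lemma zero_in_ideal [simp]: "\<zero> \<in> I"
  using ideal by (auto simp: mv_ideal_def)

lemma plus_in_ideal: "\<lbrakk>x \<in> I; y \<in> I\<rbrakk> \<Longrightarrow> x \<oplus> y \<in> I"
  using ideal by (auto simp: mv_ideal_def)

lemma ideal_down: "\<lbrakk>y \<in> I; x \<sqsubseteq> y; x \<in> carrier A\<rbrakk> \<Longrightarrow> x \<in> I"
  using ideal by (auto simp: mv_ideal_def)

abbreviation similar :: "'a \<Rightarrow> 'a \<Rightarrow> bool" (infix \<open>\<approx>\<close> 50) where
  "x \<approx> y \<equiv> x \<lesssim> y \<and> y \<lesssim> x"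

text \<open>By residuation \<open>x \<odot> \<sim> y\<close> is the least \<open>i\<close> with
  \<open>x \<sqsubseteq> y \<oplus> i\<close>. In the existential form the error terms of two
  inequalities can simply be added.\<close>

lemma below_iff:
  assumes "x \<in> carrier A" "y \<in> carrier A"
  shows "x \<lesssim> y \<longleftrightarrow> (\<exists>i\<in>I. x \<sqsubseteq> y \<oplus> i)"
proof
  assume "x \<lesssim> y"
  moreover have "x \<sqsubseteq> y \<oplus> (x \<odot> \<sim> y)"
    using assms times_le_iff[of x "\<sim> y" "x \<odot> \<sim> y"] by simp
  ultimately show "\<exists>i\<in>I. x \<sqsubseteq> y \<oplus> i" by (auto simp: below_def)
next
  assume "\<exists>i\<in>I. x \<sqsubseteq> y \<oplus> i"
  then obtain i where "i \<in> I" "x \<sqsubseteq> y \<oplus> i" by blast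
  then have "x \<odot> \<sim> y \<sqsubseteq> i" using assms in_carrier by (simp add: times_le_iff)
  then show "x \<lesssim> y" using \<open>i \<in> I\<close> assms by (auto simp: below_def intro: ideal_down)
qed

lemma le_imp_below: "\<lbrakk>x \<in> carrier A; y \<in> carrier A; x \<sqsubseteq> y\<rbrakk> \<Longrightarrow> x \<lesssim> y"
  unfolding below_iff by (rule bexI[of _ "\<zero>"]) simp_all

lemma below_refl [simp]: "x \<in> carrier A \<Longrightarrow> x \<lesssim> x"
  by (simp add: below_def)

lemma below_plus_mono:
  assumes "x \<in> carrier A" "y \<in> carrier A" "u \<in> carrier A" "v \<in> carrier A" "x \<lesssim> y" "u \<lesssim> v"
  shows "x \<oplus> u \<lesssim> y \<oplus> v"
proof -
  obtain i where i: "i \<in> I" "x \<sqsubseteq> y \<oplus> i" using assms by (auto simp: below_iff)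
  obtain j where j: "j \<in> I" "u \<sqsubseteq> v \<oplus> j" using assms by (auto simp: below_iff)
  have c: "i \<in> carrier A" "j \<in> carrier A" using i j in_carrier by auto
  have "x \<oplus> u \<sqsubseteq> (y \<oplus> i) \<oplus> (v \<oplus> j)" using i j c assms by (simp add: plus_mono)
  also have "(y \<oplus> i) \<oplus> (v \<oplus> j) = (y \<oplus> v) \<oplus> (i \<oplus> j)" using c assms by (simp add: plus_ac)
  finally show ?thesis using i j assms by (auto simp: below_iff intro: plus_in_ideal)
qed

lemma below_trans:
  assumes "x \<in> carrier A" "y \<in> carrier A" "z \<in> carrier A" "x \<lesssim> y" "y \<lesssim> z"
  shows "x \<lesssim> z"
proof -
  obtain i where i: "i \<in> I" "x \<sqsubseteq> y \<oplus> i" using assms by (auto simp: below_iff)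
  obtain j where j: "j \<in> I" "y \<sqsubseteq> z \<oplus> j" using assms by (auto simp: below_iff)
  have c: "i \<in> carrier A" "j \<in> carrier A" using i j in_carrier by auto
  have "y \<oplus> i \<sqsubseteq> (z \<oplus> j) \<oplus> i" using i j c assms by (simp add: plus_mono)
  then have "y \<oplus> i \<sqsubseteq> z \<oplus> (j \<oplus> i)" using c assms by (simp add: plus_assoc)
  then have "x \<sqsubseteq> z \<oplus> (j \<oplus> i)" using i c assms by (meson le_trans plus_closed)
  then show ?thesis using i j assms by (auto simp: below_iff intro: plus_in_ideal)
qed

lemma below_neg_swap: "\<lbrakk>x \<in> carrier A; y \<in> carrier A\<rbrakk> \<Longrightarrow> \<sim> x \<lesssim> \<sim> y \<longleftrightarrow> y \<lesssim> x"
  by (simp add: below_def times_commute)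

lemma times_in_ideal_iff: "\<lbrakk>x \<in> carrier A; y \<in> carrier A\<rbrakk> \<Longrightarrow> x \<odot> y \<in> I \<longleftrightarrow> x \<lesssim> \<sim> y"
  by (simp add: below_def)

lemma below_zero_iff: "x \<in> carrier A \<Longrightarrow> x \<lesssim> \<zero> \<longleftrightarrow> x \<in> I"
  by (simp add: below_def)

lemma below_in_ideal:
  "\<lbrakk>x \<lesssim> y; y \<in> I; x \<in> carrier A\<rbrakk> \<Longrightarrow> x \<in> I"
  by (metis below_trans below_zero_iff in_carrier zero_closed)

lemma below_times_mono:
  assumes "x \<in> carrier A" "y \<in> carrier A" "u \<in> carrier A" "v \<in> carrier A" "x \<lesssim> y" "u \<lesssim> v"
  shows "x \<odot> u \<lesssim> y \<odot> v"
  using assms by (simp add: mv_times_def below_neg_swap below_plus_mono)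

text \<open>The tool for moving adjacency from one representative of a class to another, or down to
  smaller elements.\<close>

lemma times_in_ideal_mono:
  assumes "x \<in> carrier A" "y \<in> carrier A" "u \<in> carrier A" "v \<in> carrier A"
    and "x \<lesssim> y" "u \<lesssim> v" "y \<odot> v \<in> I"
  shows "x \<odot> u \<in> I"
  using assms below_in_ideal below_times_mono by (meson times_closed)

lemma times_in_ideal: "\<lbrakk>x \<in> I; y \<in> carrier A\<rbrakk> \<Longrightarrow> x \<odot> y \<in> I"
  by (meson ideal_down in_carrier times_closed times_le)

section \<open>The quotient algebra and its classes\<close>

lemma cong_iff:
  "(x, y) \<in> mv_cong A I \<longleftrightarrow> x \<in> carrier A \<and> y \<in> carrier A \<and> x \<lesssim> y \<and> y \<lesssim> x"
proof -
  \<comment> \<open>Each summand of the distance lies below the distance; the converse direction is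
    closure of \<open>I\<close> under sums.\<close>
  have "x \<odot> \<sim> y \<in> I \<and> y \<odot> \<sim> x \<in> I" if "mv_dist A x y \<in> I" "x \<in> carrier A" "y \<in> carrier A"
  proof -
    have "x \<odot> \<sim> y \<sqsubseteq> mv_dist A x y" "y \<odot> \<sim> x \<sqsubseteq> mv_dist A x y"
      using that le_plus[of "x \<odot> \<sim> y" "y \<odot> \<sim> x"] le_plus[of "y \<odot> \<sim> x" "x \<odot> \<sim> y"]
      by (auto simp: mv_dist_def plus_commute)
    then show ?thesis using that by (auto intro: ideal_down)
  qed
  then show ?thesis by (auto simp: mv_cong_def below_def mv_dist_def intro: plus_in_ideal)
qed

lemma equiv_cong: "equiv (carrier A) (mv_cong A I)"
  by (rule equivI) (auto simp: refl_on_def sym_def trans_def cong_iff intro: below_trans)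

lemma class_eq_iff:
  "\<lbrakk>x \<in> carrier A; y \<in> carrier A\<rbrakk> \<Longrightarrow>
    mv_cong A I `` {x} = mv_cong A I `` {y} \<longleftrightarrow> x \<lesssim> y \<and> y \<lesssim> x"
  by (simp add: eq_equiv_class_iff[OF equiv_cong] cong_iff)

lemma quot_plus:
  assumes "x \<in> carrier A" "y \<in> carrier A"
  shows "mv_cong A I `` {x} \<oplus>\<^bsub>A /\<^sub>m\<^sub>v I\<^esub> mv_cong A I `` {y} = mv_cong A I `` {x \<oplus> y}"
proof -
  have "mv_cong A I `` {u \<oplus> v} = mv_cong A I `` {x \<oplus> y}"
    if "u \<in> mv_cong A I `` {x}" "v \<in> mv_cong A I `` {y}" for u v
    using that assms by (subst class_eq_iff) (auto simp: cong_iff intro: below_plus_mono)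
  \<comment> \<open>The classes are nonempty, so the union of a constant family over them equals
    that constant.\<close>
  moreover have "x \<in> mv_cong A I `` {x}" "y \<in> mv_cong A I `` {y}"
    using assms by (auto simp: cong_iff)
  ultimately show ?thesis
    unfolding mv_quot_def mv.simps by (intro SUP_eq_const) (blast | simp)+
qed

lemma quot_neg:
  assumes "x \<in> carrier A"
  shows "\<sim>\<^bsub>A /\<^sub>m\<^sub>v I\<^esub> (mv_cong A I `` {x}) = mv_cong A I `` {\<sim> x}"
proof -
  have "mv_cong A I `` {\<sim> u} = mv_cong A I `` {\<sim> x}" if "u \<in> mv_cong A I `` {x}" for u
    using that assms by (subst class_eq_iff) (auto simp: cong_iff below_neg_swap)
  moreover have "x \<in> mv_cong A I `` {x}" using assms by (auto simp: cong_iff)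
  ultimately show ?thesis
    unfolding mv_quot_def mv.simps by (intro SUP_eq_const) (blast | simp)+
qed

lemma quot_zero: "\<zero>\<^bsub>A /\<^sub>m\<^sub>v I\<^esub> = mv_cong A I `` {\<zero>}"
  by (simp add: mv_quot_def)

lemma quot_carrier: "carrier (A /\<^sub>m\<^sub>v I) = (\<lambda>x. mv_cong A I `` {x}) ` carrier A"
  by (auto simp: mv_quot_def quotient_def)

lemma zero_below [simp]: "x \<in> carrier A \<Longrightarrow> \<zero> \<lesssim> x"
  by (simp add: le_imp_below mv_le_def)

text \<open>Modulo \<open>I\<close> the element \<open>x\<close> is the top, and only zero is
  orthogonal to the top. With \<open>y = x\<close> it shows that an \<open>x\<close> outside
  \<open>I\<close> with square in \<open>I\<close> has \<open>\<sim> x\<close> outside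
  \<open>I\<close>.\<close>

lemma in_ideal_if_neg_in_ideal_times:
  assumes "x \<in> carrier A" "y \<in> carrier A" "\<sim> x \<in> I" "x \<odot> y \<in> I"
  shows "y \<in> I"
proof -
  have "y \<lesssim> \<sim> x" using assms by (simp add: below_def times_commute)
  then show ?thesis using assms below_in_ideal by blast
qed

lemma similar_neg_if_neg_in_ideal: "\<lbrakk>x \<in> carrier A; \<sim> x \<in> I\<rbrakk> \<Longrightarrow> x \<approx> \<one>"
  by (simp add: below_def times_commute[of "\<one>"])

text \<open>A form of the first isomorphism theorem: an isomorphism on classes is traded for a
  surjective homomorphism on \<open>A\<close> with kernel \<open>I\<close>, so that later arguments
  need only representatives.\<close>

lemma quot_iso_B4_iff:
  "A /\<^sub>m\<^sub>v I \<cong>\<^sub>m\<^sub>v mv_B4 \<longleftrightarrow>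
    (\<exists>\<phi> :: 'a \<Rightarrow> bool set. \<phi> ` carrier A = UNIV \<and>
      (\<forall>x \<in> carrier A. \<forall>y \<in> carrier A. \<phi> (x \<oplus> y) = \<phi> x \<union> \<phi> y) \<and>
      (\<forall>x \<in> carrier A. \<phi> (\<sim> x) = - \<phi> x) \<and>
      (\<forall>x \<in> carrier A. \<phi> x = {} \<longleftrightarrow> x \<in> I))"
    (is "_ \<longleftrightarrow> (\<exists>\<phi>. ?P \<phi>)")
proof
  let ?c = "\<lambda>x. mv_cong A I `` {x}"
  assume "A /\<^sub>m\<^sub>v I \<cong>\<^sub>m\<^sub>v mv_B4"
  then obtain h where h: "h \<in> mv_iso (A /\<^sub>m\<^sub>v I) mv_B4"
    by (auto simp: mv_isomorphic_def)
  then have bij: "bij_betw h (?c ` carrier A) UNIV"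
    by (simp add: mv_iso_def quot_carrier mv_B4_def boolean_mv_def)
  have plus: "h (?c (x \<oplus> y)) = h (?c x) \<union> h (?c y)" if "x \<in> carrier A" "y \<in> carrier A" for x y
    using h that by (simp add: mv_iso_def quot_carrier mv_B4_def boolean_mv_def flip: quot_plus)
  have neg: "h (?c (\<sim> x)) = - h (?c x)" if "x \<in> carrier A" for x
    using h that by (simp add: mv_iso_def quot_carrier mv_B4_def boolean_mv_def flip: quot_neg)
  have zero: "h (?c \<zero>) = {}"
    using h by (simp add: mv_iso_def mv_B4_def boolean_mv_def quot_zero)
  have "h (?c x) = {} \<longleftrightarrow> x \<in> I" if "x \<in> carrier A" for x
  proof -
    have "h (?c x) = {} \<longleftrightarrow> ?c x = ?c \<zero>"
      unfolding zero[symmetric] using that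
      by (intro inj_on_eq_iff[OF bij_betw_imp_inj_on[OF bij]]) auto
    then show ?thesis using that class_eq_iff[of x "\<zero>"] by (simp add: below_zero_iff)
  qed
  then have "?P (\<lambda>x. h (?c x))"
    using plus neg bij_betw_imp_surj_on[OF bij] by (simp add: image_image)
  then show "\<exists>\<phi>. ?P \<phi>" by blast
next
  let ?c = "\<lambda>x. mv_cong A I `` {x}"
  assume "\<exists>\<phi>. ?P \<phi>"
  then obtain \<phi> where \<phi>: "?P \<phi>" by blast
  have below: "x \<lesssim> y \<longleftrightarrow> \<phi> x \<subseteq> \<phi> y" if "x \<in> carrier A" "y \<in> carrier A" for x y
  proof -
    have "\<phi> (x \<odot> \<sim> y) = \<phi> x \<inter> - \<phi> y" using \<phi> that by (simp add: mv_times_def)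
    then show ?thesis using \<phi> that unfolding below_def
      by (metis Int_commute disjoint_eq_subset_Compl inf_commute neg_closed times_closed
          double_compl)
  qed
  \<comment> \<open>\<open>\<phi>\<close> is constant on each class, so its image of a class is a
    singleton and \<open>the_elem\<close> extracts the common value.\<close>
  define h where "h X = the_elem (\<phi> ` X)" for X
  have h: "h (?c x) = \<phi> x" if "x \<in> carrier A" for x
  proof -
    have "\<phi> ` ?c x = {\<phi> x}" using that by (auto simp: cong_iff below)
    then show ?thesis by (simp add: h_def)
  qed
  have "h \<in> mv_iso (A /\<^sub>m\<^sub>v I) mv_B4"
    unfolding mv_iso_def
  proof (intro CollectI conjI)
    have "inj_on h (?c ` carrier A)"
      by (auto simp: inj_on_def h class_eq_iff below simp del: Image_singleton_iff)
    moreover have "h ` ?c ` carrier A = UNIV" using \<phi> by (simp add: image_image h)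
    ultimately show "bij_betw h (carrier (A /\<^sub>m\<^sub>v I)) (carrier mv_B4)"
      by (simp add: bij_betw_def quot_carrier mv_B4_def boolean_mv_def)
  qed (use \<phi> in \<open>auto simp: quot_carrier quot_plus quot_neg quot_zero h mv_B4_def boolean_mv_def\<close>)
  then show "A /\<^sub>m\<^sub>v I \<cong>\<^sub>m\<^sub>v mv_B4" by (auto simp: mv_isomorphic_def)
qed

section \<open>Several representatives of one class\<close>

lemma plus_ideal_similar:
  assumes "y \<in> carrier A" "i \<in> I"
  shows "y \<oplus> i \<approx> y"
proof
  have "i \<in> carrier A" using assms in_carrier by blast
  then show "y \<oplus> i \<lesssim> y" "y \<lesssim> y \<oplus> i"
    using assms by (auto simp: below_iff[of "y \<oplus> i"] le_imp_below le_plus intro!: bexI[of _ i])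
qed

text \<open>Adding a nonzero \<open>i\<close> from \<open>I\<close> stays in the class. If
  \<open>x\<close> absorbs \<open>i\<close>, the shift is applied to \<open>\<sim> x\<close> and
  negated back; \<open>x\<close> and \<open>\<sim> x\<close> cannot both absorb \<open>i\<close>, by
  \<open>zero_of_absorbed_le_neg\<close>.\<close>

lemma other_representative:
  assumes "I \<noteq> {\<zero>}" "x \<in> carrier A"
  obtains y where "y \<in> carrier A" "y \<noteq> x" "x \<approx> y"
proof -
  obtain i where i: "i \<in> I" "i \<noteq> \<zero>" using assms zero_in_ideal by blast
  then have c: "i \<in> carrier A" using in_carrier by blast
  have plus: "y \<oplus> i \<approx> y" if "y \<in> carrier A" for y
    using plus_ideal_similar i that by blast
  show thesis
  proof (cases "x \<oplus> i = x")
    case False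
    then show ?thesis using that[of "x \<oplus> i"] plus assms c by auto
  next
    case True
    have "\<sim> x \<oplus> i \<noteq> \<sim> x"
    proof
      assume "\<sim> x \<oplus> i = \<sim> x"
      then have "i \<sqsubseteq> \<sim> x" using le_plus[of i "\<sim> x"] assms c by (simp add: plus_commute)
      then show False using zero_of_absorbed_le_neg True assms c i by blast
    qed
    moreover have "x \<approx> \<sim> (\<sim> x \<oplus> i)"
      using plus[of "\<sim> x"] below_neg_swap[of "\<sim> x" "\<sim> x \<oplus> i"]
        below_neg_swap[of "\<sim> x \<oplus> i" "\<sim> x"] assms c by simp
    ultimately show ?thesis
      using that[of "\<sim> (\<sim> x \<oplus> i)"] assms c by (metis neg_closed neg_neg plus_closed)
  qed
qed

end

section \<open>Girth of the ideal graph\<close>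

lemma three_le_girth: "3 \<le> girth G"
  unfolding girth_def by (intro INF_greatest) (auto simp: is_cycle_def numeral_eq_enat)

lemma girth_le: "is_cycle G c \<Longrightarrow> girth G \<le> enat (length c)"
  unfolding girth_def by (intro INF_lower) simp

lemma girth_infinite:
  assumes "vertices G \<subseteq> {a, b}"
  shows "girth G = \<infinity>"
proof -
  have "\<not> is_cycle G c" for c
  proof
    assume "is_cycle G c"
    then have "card (set c) \<ge> 3" "set c \<subseteq> {a, b}"
      using assms by (auto simp: is_cycle_def distinct_card)
    moreover have "card (set c) \<le> card {a, b}"
      using \<open>set c \<subseteq> {a, b}\<close> by (intro card_mono) auto
    moreover have "card {a, b} \<le> 2" by (simp add: card_insert_if)
    ultimately show False by simp
  qed
  then show ?thesis by (simp add: girth_def top_enat_def)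
qed

lemma carrier_chain_2: "carrier (mv_chain 2) = {0, 1}"
  by (auto simp: mv_chain_def less_2_cases_iff)

lemma carrier_chain_3: "carrier (mv_chain 3) = {0, 1/2, 1}"
  by (auto simp: mv_chain_def numeral_3_eq_3 less_Suc_eq)

lemma edge_ideal_graph:
  "{x, y} \<in> edges (ideal_graph I A) \<longleftrightarrow>
    x \<in> ideal_graph_vertices A I \<and> y \<in> ideal_graph_vertices A I \<and> x \<noteq> y \<and>
    (x \<odot>\<^bsub>A\<^esub> y \<in> I \<or> y \<odot>\<^bsub>A\<^esub> x \<in> I)"
  unfolding ideal_graph_def by (auto simp: doubleton_eq_iff)

context mv_algebra_ideal
begin

section \<open>Triangles and the two exceptional cases\<close>

lemma girth_triangle:
  assumes "x \<in> carrier A - I" "y \<in> carrier A - I" "z \<in> carrier A - I"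
    and "x \<noteq> y" "y \<noteq> z" "z \<noteq> x"
    and "x \<odot> y \<in> I" "y \<odot> z \<in> I" "z \<odot> x \<in> I"
  shows "girth (ideal_graph I A) = 3"
proof -
  have "{x, y, z} \<subseteq> ideal_graph_vertices A I"
    using assms by (auto simp: ideal_graph_vertices_def)
  then have "is_cycle (ideal_graph I A) [x, y, z]"
    using assms unfolding is_cycle_def
    by (auto simp: less_Suc_eq edge_ideal_graph) (auto simp: ideal_graph_def)
  from girth_le[OF this] have "girth (ideal_graph I A) \<le> 3"
    by (simp add: numeral_eq_enat eval_nat_numeral)
  then show ?thesis using three_le_girth by (rule antisym)
qed

text \<open>Two representatives of each of the two atoms, taken alternately, form a 4-cycle. A
  triangle would give three pairwise disjoint nonempty subsets of \<open>bool\<close>.\<close>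

lemma girth_B4:
  assumes "I \<noteq> {\<zero>}" and iso: "A /\<^sub>m\<^sub>v I \<cong>\<^sub>m\<^sub>v mv_B4"
  shows "girth (ideal_graph I A) = 4"
proof -
  obtain \<phi> :: "'a \<Rightarrow> bool set" where surj: "\<phi> ` carrier A = UNIV"
    and plus: "\<And>x y. x \<in> carrier A \<Longrightarrow> y \<in> carrier A \<Longrightarrow> \<phi> (x \<oplus> y) = \<phi> x \<union> \<phi> y"
    and neg: "\<And>x. x \<in> carrier A \<Longrightarrow> \<phi> (\<sim> x) = - \<phi> x"
    and kernel: "\<And>x. x \<in> carrier A \<Longrightarrow> x \<in> I \<longleftrightarrow> \<phi> x = {}"
    using iso unfolding quot_iso_B4_iff by auto
  have times: "x \<odot> y \<in> I \<longleftrightarrow> \<phi> x \<inter> \<phi> y = {}" if "x \<in> carrier A" "y \<in> carrier A" for x y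
    using that by (simp add: kernel) (simp add: mv_times_def plus neg)
  have similar: "\<phi> x = \<phi> y" if "x \<in> carrier A" "y \<in> carrier A" "x \<approx> y" for x y
    using that times[of x "\<sim> y"] times[of y "\<sim> x"] by (auto simp: below_def neg)
  obtain x where x: "x \<in> carrier A" "\<phi> x = {True}" using surj by (metis UNIV_I imageE)
  obtain y where y: "y \<in> carrier A" "\<phi> y = {False}" using surj by (metis UNIV_I imageE)
  obtain x' where x': "x' \<in> carrier A" "x' \<noteq> x" "\<phi> x' = {True}"
    using other_representative[OF assms(1) x(1)] similar x by metis
  obtain y' where y': "y' \<in> carrier A" "y' \<noteq> y" "\<phi> y' = {False}"
    using other_representative[OF assms(1) y(1)] similar y by metis
  have ne: "x \<noteq> y" "x \<noteq> y'" "x' \<noteq> y" "x' \<noteq> y'" using x y x' y' by auto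
  have adj: "x \<odot> y \<in> I" "y \<odot> x' \<in> I" "x' \<odot> y' \<in> I" "y' \<odot> x \<in> I"
    using x y x' y' by (simp_all add: times)
  have vertex: "z \<in> ideal_graph_vertices A I"
    if "z \<in> carrier A" "w \<in> carrier A" "\<phi> z \<noteq> {}" "\<phi> w \<noteq> {}" "\<phi> z \<inter> \<phi> w = {}" for z w
    using that kernel[of z] kernel[of w] times[of z w]
    by (auto simp: ideal_graph_vertices_def intro!: bexI[of _ w])
  have "{x, y, x', y'} \<subseteq> ideal_graph_vertices A I"
    using vertex[of x y] vertex[of y x] vertex[of x' y] vertex[of y' x] x y x' y' by simp
  then have "is_cycle (ideal_graph I A) [x, y, x', y']"
    using adj x'(2) y'(2) ne unfolding is_cycle_def
    by (auto simp: less_Suc_eq edge_ideal_graph) (auto simp: ideal_graph_def)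
  from girth_le[OF this] have "girth (ideal_graph I A) \<le> 4"
    by (simp add: numeral_eq_enat eval_nat_numeral)
  moreover have "4 \<le> length c" if "is_cycle (ideal_graph I A) c" for c
  proof (rule ccontr)
    assume "\<not> 4 \<le> length c"
    then have "length c = 3" using that by (simp add: is_cycle_def)
    then obtain u v w where c: "c = [u, v, w]"
      by (auto simp: numeral_3_eq_3 length_Suc_conv)
    have "{u, v, w} \<subseteq> carrier A - I" "u \<odot> v \<in> I \<or> v \<odot> u \<in> I" "v \<odot> w \<in> I \<or> w \<odot> v \<in> I"
        "w \<odot> u \<in> I \<or> u \<odot> w \<in> I"
      using that unfolding c is_cycle_def
      by (auto simp: All_less_Suc edge_ideal_graph ideal_graph_vertices_def)
    then have "\<phi> u \<noteq> {}" "\<phi> v \<noteq> {}" "\<phi> w \<noteq> {}"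
        "\<phi> u \<inter> \<phi> v = {}" "\<phi> v \<inter> \<phi> w = {}" "\<phi> w \<inter> \<phi> u = {}"
      by (simp_all add: times Int_commute flip: kernel)
    then obtain p q r where "p \<in> \<phi> u" "q \<in> \<phi> v" "r \<in> \<phi> w" "p \<noteq> q" "q \<noteq> r" "r \<noteq> p" by blast
    then show False by auto
  qed
  then have "4 \<le> girth (ideal_graph I A)"
    unfolding girth_def by (intro INF_greatest) (auto simp: numeral_eq_enat)
  ultimately show ?thesis by (rule antisym)
qed

text \<open>The vertices of the graph lie over the middle element of \<open>L\<^sub>3\<close>.\<close>

lemma girth_L2_L3:
  assumes h: "h \<in> mv_iso A (mv_chain 2 \<times>\<^sub>m\<^sub>v mv_chain 3)"
    and hI: "h ` I = carrier (mv_chain 2) \<times> {mv_zero (mv_chain 3)}"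
  shows "girth (ideal_graph I A) = \<infinity>"
proof -
  have bij: "bij_betw h (carrier A) ({0, 1} \<times> {0, 1/2, 1})"
    using h by (simp add: mv_iso_def mv_prod_def carrier_chain_2 carrier_chain_3)
  have kernel: "x \<in> I \<longleftrightarrow> snd (h x) = 0" if "x \<in> carrier A" for x
  proof -
    have "h x \<in> {0, 1} \<times> {0, 1/2, 1}" using bij that by (auto simp: bij_betw_def)
    moreover have "x \<in> I \<longleftrightarrow> h x \<in> h ` I"
      using bij that in_carrier by (auto simp: bij_betw_def inj_on_def)
    ultimately show ?thesis unfolding hI by (auto simp: carrier_chain_2 mv_chain_def)
  qed
  have snd_times: "snd (h (x \<odot> y)) = max 0 (snd (h x) + snd (h y) - 1)"
    if "x \<in> carrier A" "y \<in> carrier A" for x y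
    using h that by (simp add: mv_times_def mv_iso_def mv_prod_def mv_chain_def)
  define a where "a = inv_into (carrier A) h (0, 1/2)"
  define b where "b = inv_into (carrier A) h (1, 1/2)"
  have "x \<in> {a, b}" if vertex: "x \<in> ideal_graph_vertices A I" for x
  proof -
    obtain y where y: "y \<in> carrier A" "snd (h y) \<noteq> 0" "x \<odot> y \<in> I"
      using vertex kernel by (auto simp: ideal_graph_vertices_def)
    have x: "x \<in> carrier A" "snd (h x) \<noteq> 0"
      using vertex kernel by (auto simp: ideal_graph_vertices_def)
    have mem: "h x \<in> {0, 1} \<times> {0, 1/2, 1}" "h y \<in> {0, 1} \<times> {0, 1/2, 1}"
      using bij x y by (auto simp: bij_betw_def)
    \<comment> \<open>Both second coordinates are at least \<open>1/2\<close> and their sum is at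
      most \<open>1\<close>, so both equal \<open>1/2\<close>.\<close>
    have "max 0 (snd (h x) + snd (h y) - 1) = 0"
      using y x snd_times kernel by (metis times_closed)
    then have "h x = (0, 1/2) \<or> h x = (1, 1/2)" using mem x y by (auto split: if_splits simp: max_def)
    moreover have "x = inv_into (carrier A) h (h x)" using bij x by (simp add: bij_betw_def)
    ultimately show ?thesis unfolding a_def b_def by (metis insertCI)
  qed
  then show ?thesis
    by (intro girth_infinite[of _ a b]) (auto simp: ideal_graph_def)
qed

section \<open>An element outside the ideal whose square is in the ideal\<close>

lemma girth_nilpotent:
  assumes "I \<noteq> {\<zero>}"
    and x: "x \<in> carrier A" "x \<notin> I" "x \<odot> x \<in> I"
    and z: "z \<in> carrier A" "z \<notin> I" "x \<odot> z \<in> I" "\<not> x \<approx> z"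
  shows "girth (ideal_graph I A) = 3"
proof -
  obtain x' where x': "x' \<in> carrier A" "x' \<noteq> x" "x \<approx> x'"
    using other_representative assms by metis
  have "x' \<odot> z \<in> I" "x \<odot> x' \<in> I"
    using times_in_ideal_mono[of x' x z z] times_in_ideal_mono[of x x x' x] x x' z by auto
  moreover have "x' \<notin> I" using x x' below_in_ideal by blast
  moreover have "x' \<noteq> z" "z \<noteq> x" using x x' z by auto
  ultimately show ?thesis
    using girth_triangle[of x x' z] x x' z by (simp add: times_commute)
qed

text \<open>If \<open>x\<close> has no neighbour outside its own class, then
  \<open>x \<approx> \<sim> x\<close>, and every class other than bottom and top is that of
  \<open>x\<close>: for any \<open>y\<close> in such a class, one of \<open>y\<close>,
  \<open>\<sim> y\<close> turns out to be orthogonal to \<open>x\<close>.\<close>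

lemma nilpotent_quotient_three:
  assumes x: "x \<in> carrier A" "x \<notin> I" "x \<odot> x \<in> I"
    and unique: "\<And>z. \<lbrakk>z \<in> carrier A; z \<notin> I; x \<odot> z \<in> I\<rbrakk> \<Longrightarrow> x \<approx> z"
    and y: "y \<in> carrier A" "y \<notin> I" "\<sim> y \<notin> I"
  shows "x \<approx> y"
proof -
  have "\<sim> x \<notin> I" using x in_ideal_if_neg_in_ideal_times by blast
  then have neg_x: "x \<approx> \<sim> x" using unique[of "\<sim> x"] x by simp
  consider "x \<odot> y \<in> I" | "x \<odot> \<sim> y \<in> I" | "x \<odot> y \<notin> I" "x \<odot> \<sim> y \<notin> I" by blast
  then show ?thesis
  proof cases
    case 1
    then show ?thesis using unique x y by blast
  next
    case 2
    then have "x \<approx> \<sim> y" using unique[of "\<sim> y"] x y by simp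
    then have "\<sim> x \<approx> y" using below_neg_swap[of "\<sim> y" x] below_neg_swap[of x "\<sim> y"] x y by simp
    then show ?thesis using neg_x x y below_trans by (meson neg_closed)
  next
    case 3
    \<comment> \<open>As \<open>x \<odot> x\<close> is in \<open>I\<close>, the product
      \<open>x \<odot> y\<close> is itself a neighbour of \<open>x\<close>, hence similar to it.
      Multiplying by \<open>\<sim> y\<close> then contradicts the case assumption.\<close>
    have "x \<odot> (x \<odot> y) \<in> I" using x y times_in_ideal by (simp flip: times_assoc)
    then have "x \<lesssim> x \<odot> y" using 3 unique[of "x \<odot> y"] x y by simp
    then have "x \<odot> \<sim> y \<in> I"
      using times_in_ideal_mono[of x "x \<odot> y" "\<sim> y" "\<sim> y"] x y by (simp add: times_assoc)
    then show ?thesis using 3 by simp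
  qed
qed

text \<open>The middle class is a pair \<open>u\<close>, \<open>v = u \<oplus> i\<close> exchanged
  by complement. This pins down \<open>I\<close> as \<open>{\<zero>, i}\<close>, then the six
  elements of \<open>A\<close>, then the whole addition table.\<close>

lemma iso_L2_L3:
  assumes "I \<noteq> {\<zero>}"
    and x: "x \<in> carrier A" "x \<notin> I" "\<sim> x \<notin> I"
    and cover: "\<And>z. \<lbrakk>z \<in> carrier A; z \<notin> I; \<sim> z \<notin> I\<rbrakk> \<Longrightarrow> x \<approx> z"
    and two: "\<And>z. \<lbrakk>z \<in> carrier A; x \<approx> z\<rbrakk> \<Longrightarrow> z = x \<or> z = x'"
  shows "\<exists>h \<in> mv_iso A (mv_chain 2 \<times>\<^sub>m\<^sub>v mv_chain 3).
    h ` I = carrier (mv_chain 2) \<times> {mv_zero (mv_chain 3)}"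
proof -
  define S where "S = {z \<in> carrier A. x \<approx> z}"
  have S_iff: "z \<in> S \<longleftrightarrow> z \<in> carrier A \<and> z \<notin> I \<and> \<sim> z \<notin> I" for z
  proof
    assume "z \<in> S"
    then have z: "z \<in> carrier A" "x \<lesssim> z" "\<sim> x \<lesssim> \<sim> z"
      using x by (auto simp: S_def below_neg_swap)
    then show "z \<in> carrier A \<and> z \<notin> I \<and> \<sim> z \<notin> I" using x below_in_ideal by auto
  qed (use cover in \<open>simp add: S_def\<close>)
  have S_carrier: "z \<in> carrier A" if "z \<in> S" for z
    using that by (simp add: S_iff)
  have S_neg: "\<sim> z \<in> S" if "z \<in> S" for z
    using that by (simp add: S_iff)
  have S_plus: "z \<oplus> k \<in> S" if "z \<in> S" "k \<in> I" for z k
    using that x plus_ideal_similar[of z k] in_carrier unfolding S_def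
    by (auto intro: below_trans[of _ z])
  have S_below: "z \<lesssim> w" if "z \<in> S" "w \<in> S" for z w
    using that x unfolding S_def by (auto intro: below_trans[of _ x])
  have x_in: "x \<in> S" using x by (simp add: S_def)
  obtain i where i: "i \<in> I" "i \<noteq> \<zero>" using assms(1) zero_in_ideal by blast
  then have ic [simp]: "i \<in> carrier A" using in_carrier by blast
  \<comment> \<open>As in \<open>other_representative\<close>, \<open>x\<close> and
    \<open>\<sim> x\<close> cannot both absorb \<open>i\<close>.\<close>
  have "\<exists>u \<in> S. u \<oplus> i \<noteq> u"
  proof (rule ccontr)
    assume "\<not> ?thesis"
    then have "x \<oplus> i = x" "\<sim> x \<oplus> i = \<sim> x" using x_in S_neg by auto
    then have "i \<sqsubseteq> \<sim> x" using le_plus[of i "\<sim> x"] x by (simp add: plus_commute)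
    then show False using zero_of_absorbed_le_neg[of x i] \<open>x \<oplus> i = x\<close> x i by simp
  qed
  then obtain u where u: "u \<in> S" "u \<oplus> i \<noteq> u" by blast
  define v where "v = u \<oplus> i"
  have v: "v \<in> S" "v \<noteq> u" using u S_plus i by (auto simp: v_def)
  have uvc [simp]: "u \<in> carrier A" "v \<in> carrier A" using u v S_carrier by auto
  have S_uv: "z = u \<or> z = v" if "z \<in> S" for z
    using that u v two unfolding S_def by blast
  have "u \<sqsubseteq> v" by (simp add: v_def le_plus)
  then have not_le: "\<not> v \<sqsubseteq> u" using v le_antisym[of u v] by auto
  \<comment> \<open>Adding \<open>k\<close> moves upwards inside the pair, and \<open>v\<close> is
    its larger member.\<close>
  have v_plus: "v \<oplus> k = v" if "k \<in> I" for k
  proof -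
    have "v \<sqsubseteq> v \<oplus> k" using that in_carrier by (simp add: le_plus)
    then show ?thesis using S_uv[OF S_plus[OF v(1) that]] not_le by auto
  qed
  \<comment> \<open>Otherwise complement fixes both \<open>u\<close> and \<open>v\<close>, and being
    order-reversing it turns \<open>u \<sqsubseteq> v\<close> into
    \<open>v \<sqsubseteq> u\<close>.\<close>
  have neg_u: "\<sim> u = v"
  proof (rule ccontr)
    assume "\<sim> u \<noteq> v"
    then have nu: "\<sim> u = u" using S_uv[OF S_neg[OF u(1)]] by blast
    have "\<sim> v \<noteq> u"
      using nu v by (metis neg_neg uvc(2))
    then have "\<sim> v = v" using S_uv[OF S_neg[OF v(1)]] by blast
    then have "v \<sqsubseteq> u" using \<open>u \<sqsubseteq> v\<close> le_neg_iff[of u v] nu by simp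
    then show False using not_le by blast
  qed
  then have neg_v: "\<sim> v = u" using neg_neg uvc(1) by metis
  \<comment> \<open>Here \<open>k\<close> is its own meet with \<open>v\<close>, which is
    \<open>v \<odot> (u \<oplus> k)\<close>. As \<open>k\<close> lies below \<open>\<sim> u\<close>
    and is nonzero, \<open>u\<close> cannot absorb it, so \<open>u \<oplus> k = v\<close> and the
    value no longer depends on \<open>k\<close>.\<close>
  have determined: "k = v \<odot> v" if "k \<in> I" "k \<noteq> \<zero>" for k
  proof -
    have kc: "k \<in> carrier A" using that in_carrier by blast
    have "k \<sqsubseteq> k \<oplus> v" using kc by (simp add: le_plus)
    then have kv: "k \<sqsubseteq> v" using v_plus[OF that(1)] kc by (simp add: plus_commute)
    then have "u \<oplus> k \<noteq> u" using zero_of_absorbed_le_neg[of u k] that kc neg_u by auto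
    then have "u \<oplus> k = v" using S_uv[OF S_plus[OF u(1) that(1)]] by blast
    moreover have "k = k \<odot> (\<sim> k \<oplus> v)" using kv kc by (simp add: mv_le_def)
    ultimately show ?thesis using meet_commute[of k v] kc neg_v by simp
  qed
  have I_eq: "I = {\<zero>, i}" using determined i zero_in_ideal by blast
  define j where "j = \<sim> i"
  have jc [simp]: "j \<in> carrier A" and neg_i: "\<sim> i = j" and neg_j: "\<sim> j = i"
    by (simp_all add: j_def)
  have carrier: "carrier A = {\<zero>, i, u, v, j, \<one>}"
  proof (intro equalityI subsetI)
    fix z assume z: "z \<in> carrier A"
    consider "z \<in> I" | "\<sim> z \<in> I" | "z \<in> S" using z S_iff by blast
    then show "z \<in> {\<zero>, i, u, v, j, \<one>}"
      by cases (use z S_uv in \<open>auto simp: I_eq neg_eq_iff j_def\<close>)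
  qed auto
  have ii: "i \<oplus> i = i"
  proof -
    have "i \<oplus> i \<noteq> \<zero>" using le_plus[of i i] le_zero_iff[of i] i by auto
    then show ?thesis using plus_in_ideal[of i i] i I_eq by auto
  qed
  \<comment> \<open>Only \<open>j\<close> and \<open>\<one>\<close> have their complement in
    \<open>I\<close>; a sum in the top class is thus identified by excluding
    \<open>\<one>\<close>.\<close>
  have eq_j: "z = j" if "z \<in> carrier A" "\<sim> z \<in> I" "z \<noteq> \<one>" for z
    using that by (auto simp: I_eq neg_eq_iff j_def)
  have uu: "u \<oplus> u = j"
  proof (rule eq_j)
    have "v \<odot> v \<in> I" using S_below[of v "\<sim> v"] u v neg_v by (simp add: times_in_ideal_iff)
    then show "\<sim> (u \<oplus> u) \<in> I" by (simp add: mv_times_def neg_v)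
    show "u \<oplus> u \<noteq> \<one>" using not_le by (simp add: mv_le_def neg_v)
  qed simp
  have uj: "u \<oplus> j = j"
  proof (rule eq_j)
    have "i \<odot> v \<in> I" using i times_in_ideal by simp
    then show "\<sim> (u \<oplus> j) \<in> I" by (simp add: mv_times_def neg_v neg_i plus_commute)
    show "u \<oplus> j \<noteq> \<one>"
    proof
      assume "u \<oplus> j = \<one>"
      then have "i \<sqsubseteq> \<sim> v" by (simp add: mv_le_def neg_v neg_i plus_commute)
      then show False using zero_of_absorbed_le_neg[of v i] v_plus i by simp
    qed
  qed simp
  have uv: "u \<oplus> v = \<one>" using neg_u plus_neg_self[of u] by simp
  have ij: "i \<oplus> j = \<one>" by (simp add: j_def)
  have vv: "v \<oplus> v = \<one>"
  proof -
    have "v \<oplus> v = i \<oplus> (u \<oplus> v)" by (simp add: v_def plus_ac)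
    then show ?thesis by (simp add: uv)
  qed
  have vj: "v \<oplus> j = \<one>" by (simp add: v_def plus_assoc ij)
  have jj: "j \<oplus> j = j"
  proof -
    have "j \<oplus> j = u \<oplus> (u \<oplus> j)" by (simp add: uu[symmetric] plus_assoc)
    then show ?thesis by (simp add: uj)
  qed
  have flip: "i \<oplus> u = v" "i \<oplus> v = v" "v \<oplus> u = \<one>" "j \<oplus> i = \<one>" "j \<oplus> u = j" "j \<oplus> v = \<one>"
    using v_def v_plus[OF i(1)] uv ij uj vj by (simp_all add: plus_commute)
  note table = ii uu uj uv ij vv vj jj flip v_def[symmetric] v_plus[OF i(1)]
    neg_i neg_j neg_u neg_v
  have "\<one> \<notin> I" using x ideal_down[of "\<one>" x] in_ideal_if_neg_in_ideal_times[of "\<one>" x]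
    times_in_ideal[of "\<one>" x] by (auto simp: times_commute)
  moreover have "j \<notin> I"
    using plus_in_ideal[of i j] i ij \<open>\<one> \<notin> I\<close> by auto
  moreover have "j \<noteq> \<one>" using i neg_j by auto
  moreover have "u \<notin> I" "v \<notin> I" "u \<noteq> \<one>" "v \<noteq> \<one>" "u \<noteq> j" "v \<noteq> j"
    using u v i by (auto simp: S_iff neg_j)
  ultimately have distinct: "distinct [\<zero>, i, u, v, j, \<one>]"
    using i v unfolding I_eq by auto
  \<comment> \<open>The first coordinate is \<open>1\<close> exactly on the elements that absorb
    \<open>i\<close>; the second is the position modulo \<open>I\<close>: bottom, middle or
    top.\<close>
  define h :: "'a \<Rightarrow> real \<times> real" where
    "h z = (if z = \<zero> then (0, 0) else if z = i then (1, 0) else if z = u then (0, 1/2)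
       else if z = v then (1, 1/2) else if z = j then (0, 1) else (1, 1))" for z
  have h: "h \<zero> = (0, 0)" "h i = (1, 0)" "h u = (0, 1/2)" "h v = (1, 1/2)" "h j = (0, 1)"
    "h \<one> = (1, 1)"
    using distinct by (auto simp: h_def)
  have "h \<in> mv_iso A (mv_chain 2 \<times>\<^sub>m\<^sub>v mv_chain 3)"
    unfolding mv_iso_def
  proof (intro CollectI conjI ballI)
    show "bij_betw h (carrier A) (carrier (mv_chain 2 \<times>\<^sub>m\<^sub>v mv_chain 3))"
      unfolding mv_prod_def
      by (auto simp: bij_betw_def inj_on_def carrier carrier_chain_2 carrier_chain_3 h)
    show "h (a \<oplus> b) = h a \<oplus>\<^bsub>mv_chain 2 \<times>\<^sub>m\<^sub>v mv_chain 3\<^esub> h b"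
      if "a \<in> carrier A" "b \<in> carrier A" for a b
    proof -
      have "a = \<zero> \<or> a = i \<or> a = u \<or> a = v \<or> a = j \<or> a = \<one>"
        "b = \<zero> \<or> b = i \<or> b = u \<or> b = v \<or> b = j \<or> b = \<one>"
        using that unfolding carrier by auto
      then show ?thesis
        by (elim disjE) (simp_all add: table h mv_prod_def mv_chain_def)
    qed
    show "h (\<sim> a) = \<sim>\<^bsub>mv_chain 2 \<times>\<^sub>m\<^sub>v mv_chain 3\<^esub> (h a)" if "a \<in> carrier A" for a
      using that unfolding carrier by (auto simp: table h mv_prod_def mv_chain_def)
    show "h \<zero> = \<zero>\<^bsub>mv_chain 2 \<times>\<^sub>m\<^sub>v mv_chain 3\<^esub>"
      by (simp add: h mv_prod_def mv_chain_def)
  qed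
  moreover have "h ` I = carrier (mv_chain 2) \<times> {mv_zero (mv_chain 3)}"
    by (auto simp: I_eq h carrier_chain_2 mv_chain_def)
  ultimately show ?thesis by blast
qed

section \<open>The reduced case: only elements of the ideal have their square in it\<close>

lemma girth_reduced:
  assumes reduced: "\<And>z. \<lbrakk>z \<in> carrier A; z \<odot> z \<in> I\<rbrakk> \<Longrightarrow> z \<in> I"
    and x: "x \<in> carrier A" "x \<notin> I" "\<sim> x \<notin> I"
    and y: "y \<in> carrier A" "y \<notin> I" "\<sim> y \<notin> I"
    and "\<not> x \<approx> y" "\<not> \<sim> x \<approx> y"
  shows "girth (ideal_graph I A) = 3"
proof -
  \<comment> \<open>Distinctness is automatic: two equal vertices would have their square in
    \<open>I\<close>.\<close>
  have triangle: "girth (ideal_graph I A) = 3"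
    if "p \<in> carrier A" "q \<in> carrier A" "r \<in> carrier A" "p \<notin> I" "q \<notin> I" "r \<notin> I"
      and "p \<odot> q \<in> I" "q \<odot> r \<in> I" "r \<odot> p \<in> I" for p q r
  proof -
    have "p \<noteq> q" "q \<noteq> r" "r \<noteq> p" using that reduced by blast+
    then show ?thesis using that girth_triangle[of p q r] by simp
  qed
  \<comment> \<open>The third vertex is what remains of \<open>\<sim> x\<close> after removing
    \<open>w\<close>. It is outside \<open>I\<close> because \<open>w \<lesssim> \<sim> x\<close>
    holds while similarity is excluded.\<close>
  have disjoint: "girth (ideal_graph I A) = 3"
    if w: "w \<in> carrier A" "w \<notin> I" "x \<odot> w \<in> I" "\<not> \<sim> x \<approx> w" for w
  proof (rule triangle[of x w "\<sim> x \<odot> \<sim> w"])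
    have "\<not> \<sim> x \<lesssim> w"
      using w x by (auto simp: below_def times_commute)
    then show "\<sim> x \<odot> \<sim> w \<notin> I" by (simp add: below_def)
    have "w \<odot> (\<sim> w \<odot> \<sim> x) = \<zero>"
      using x w by (simp flip: times_assoc) (simp add: times_commute[of "\<zero>"])
    then show "w \<odot> (\<sim> x \<odot> \<sim> w) \<in> I"
      using x w by (simp add: times_commute)
    have "x \<odot> (\<sim> x \<odot> \<sim> w) = \<zero>"
      using x w by (simp flip: times_assoc) (simp add: times_commute[of "\<zero>"])
    then show "\<sim> x \<odot> \<sim> w \<odot> x \<in> I"
      using x w by (simp add: times_commute)
  qed (use x w in auto)
  consider "x \<odot> y \<in> I" | "x \<odot> \<sim> y \<in> I" | "x \<odot> y \<notin> I" "x \<odot> \<sim> y \<notin> I" by blast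
  then show ?thesis
  proof cases
    case 1
    then show ?thesis using disjoint[of y] y assms by blast
  next
    case 2
    have "\<not> \<sim> x \<approx> \<sim> y" using assms below_neg_swap by blast
    then show ?thesis using 2 disjoint[of "\<sim> y"] y by simp
  next
    case 3
    have le: "a \<odot> b \<lesssim> a" "a \<odot> b \<lesssim> b" if "a \<in> carrier A" "b \<in> carrier A" for a b
      using that times_le[of a b] times_le[of b a] by (simp_all add: le_imp_below times_commute)
    \<comment> \<open>The triangle consists of the two pieces into which \<open>y\<close> cuts
      \<open>x\<close>, together with \<open>\<sim> x\<close>.\<close>
    have "x \<odot> y \<odot> \<sim> x \<in> I" "x \<odot> \<sim> y \<odot> \<sim> x \<in> I" "x \<odot> y \<odot> (x \<odot> \<sim> y) \<in> I"
      using times_in_ideal_mono[of "x \<odot> y" x "\<sim> x" "\<sim> x"]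
        times_in_ideal_mono[of "x \<odot> \<sim> y" x "\<sim> x" "\<sim> x"]
        times_in_ideal_mono[of "x \<odot> y" y "x \<odot> \<sim> y" "\<sim> y"] x y le by simp_all
    then show ?thesis
      using triangle[of "x \<odot> y" "x \<odot> \<sim> y" "\<sim> x"] 3 x y by (simp add: times_commute)
  qed
qed

text \<open>Modulo \<open>I\<close> addition is idempotent and \<open>x\<close>,
  \<open>\<sim> x\<close> behave as the two atoms. Recording which atoms an element meets gives the
  homomorphism required by \<open>quot_iso_B4_iff\<close>.\<close>

lemma quot_iso_B4:
  assumes reduced: "\<And>z. \<lbrakk>z \<in> carrier A; z \<odot> z \<in> I\<rbrakk> \<Longrightarrow> z \<in> I"
    and x: "x \<in> carrier A" "x \<notin> I" "\<sim> x \<notin> I"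
    and cover: "\<And>z. \<lbrakk>z \<in> carrier A; z \<notin> I; \<sim> z \<notin> I\<rbrakk> \<Longrightarrow> x \<approx> z \<or> \<sim> x \<approx> z"
  shows "A /\<^sub>m\<^sub>v I \<cong>\<^sub>m\<^sub>v mv_B4"
proof -
  have idem: "w \<oplus> w \<lesssim> w" if w: "w \<in> carrier A" for w
  proof -
    \<comment> \<open>the meet of \<open>w\<close> and \<open>\<sim> w\<close>\<close>
    define c where "c = (w \<oplus> w) \<odot> \<sim> w"
    have cc: "c \<in> carrier A" using w by (simp add: c_def)
    have "c = w \<odot> (\<sim> w \<oplus> \<sim> w)"
      using w meet_commute[of w "\<sim> w"] by (simp add: c_def times_commute)
    then have "c \<sqsubseteq> w" "c \<sqsubseteq> \<sim> w"
      using w times_le[of "\<sim> w" "w \<oplus> w"] times_le[of w "\<sim> w \<oplus> \<sim> w"]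
      by (simp_all add: c_def times_commute)
    \<comment> \<open>\<open>c \<odot> c\<close> is below
      \<open>w \<odot> \<sim> w = \<zero>\<close>.\<close>
    then have "c \<odot> c \<in> I"
      using times_in_ideal_mono[of c w c "\<sim> w"] w cc by (simp add: le_imp_below)
    then have "c \<in> I" using reduced cc by blast
    then show ?thesis by (simp add: below_def c_def)
  qed
  \<comment> \<open>Idempotence at \<open>\<sim> w\<close> makes the elements orthogonal to
    \<open>w\<close> closed under sums.\<close>
  have plus: "(a \<oplus> b) \<odot> w \<in> I \<longleftrightarrow> a \<odot> w \<in> I \<and> b \<odot> w \<in> I"
    if "a \<in> carrier A" "b \<in> carrier A" "w \<in> carrier A" for a b w
  proof -
    have "a \<lesssim> a \<oplus> b" "b \<lesssim> a \<oplus> b"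
      using that le_plus[of a b] le_plus[of b a] by (simp_all add: le_imp_below plus_commute)
    moreover have "a \<oplus> b \<lesssim> \<sim> w" if "a \<lesssim> \<sim> w" "b \<lesssim> \<sim> w"
      using below_plus_mono[of a "\<sim> w" b "\<sim> w"] idem[of "\<sim> w"] that
        below_trans[of "a \<oplus> b" "\<sim> w \<oplus> \<sim> w" "\<sim> w"] \<open>a \<in> carrier A\<close> \<open>b \<in> carrier A\<close> \<open>w \<in> carrier A\<close>
      by simp
    ultimately show ?thesis
      using that below_trans[of a "a \<oplus> b" "\<sim> w"] below_trans[of b "a \<oplus> b" "\<sim> w"]
      by (auto simp: times_in_ideal_iff)
  qed
  \<comment> \<open>The atom property: modulo \<open>I\<close>, each \<open>z\<close> either lies
    above \<open>w\<close> or is orthogonal to it. Both at once would give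
    \<open>w \<lesssim> \<sim> w\<close>, against reducedness.\<close>
  have neg: "\<sim> z \<odot> w \<in> I \<longleftrightarrow> z \<odot> w \<notin> I"
    if z: "z \<in> carrier A" and w: "w = x \<or> w = \<sim> x" for z w
  proof -
    have wc: "w \<in> carrier A" "w \<notin> I" using w x by auto
    have 1: "\<sim> z \<odot> w \<in> I \<longleftrightarrow> w \<lesssim> z" using z wc by (simp add: below_def times_commute)
    have 2: "z \<odot> w \<in> I \<longleftrightarrow> z \<lesssim> \<sim> w" using z wc by (simp add: times_in_ideal_iff)
    have "\<not> (w \<lesssim> z \<and> z \<lesssim> \<sim> w)"
      using below_trans[of w z "\<sim> w"] reduced[of w] wc z by (auto simp: times_in_ideal_iff)
    moreover have "w \<lesssim> z \<or> z \<lesssim> \<sim> w"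
    proof -
      consider "z \<in> I" | "\<sim> z \<in> I" | "x \<approx> z \<or> \<sim> x \<approx> z" using cover z by blast
      then show ?thesis
      proof cases
        case 1
        then have "z \<odot> w \<in> I" using times_in_ideal wc by blast
        then show ?thesis using 2 by blast
      next
        case 2
        then have "\<sim> z \<odot> w \<in> I" using times_in_ideal wc by blast
        then show ?thesis using 1 by blast
      next
        case 3
        then show ?thesis using w x by auto
      qed
    qed
    ultimately show ?thesis using 1 2 by blast
  qed
  \<comment> \<open>\<open>True\<close> stands for the atom \<open>x\<close>, \<open>False\<close>
    for the atom \<open>\<sim> x\<close>.\<close>
  define \<phi> where "\<phi> z = {b. if b then z \<odot> x \<notin> I else z \<odot> \<sim> x \<notin> I}" for z
  have "\<phi> z = {} \<longleftrightarrow> z \<in> I" if z: "z \<in> carrier A" for z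
  proof
    assume "\<phi> z = {}"
    then have "z \<odot> x \<in> I" "z \<odot> \<sim> x \<in> I" by (auto simp: \<phi>_def split: if_splits)
    then have "z \<odot> z \<in> I"
      using times_in_ideal_mono[of z x z "\<sim> x"] x z by (simp add: below_def)
    then show "z \<in> I" using reduced z by blast
  qed (use x times_in_ideal in \<open>auto simp: \<phi>_def\<close>)
  moreover have "\<phi> (\<sim> z) = - \<phi> z" if "z \<in> carrier A" for z
    using neg[OF that] x by (auto simp: \<phi>_def)
  moreover have "\<phi> (a \<oplus> b) = \<phi> a \<union> \<phi> b" if "a \<in> carrier A" "b \<in> carrier A" for a b
    using plus[OF that] x by (auto simp: \<phi>_def)
  moreover have "B \<in> \<phi> ` carrier A" for B
  proof -
    have "x \<odot> x \<notin> I" "\<sim> x \<odot> \<sim> x \<notin> I"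
      using reduced[of x] reduced[of "\<sim> x"] x by auto
    then have \<phi>: "\<phi> x = {True}" "\<phi> (\<sim> x) = {False}" "\<phi> \<zero> = {}" "\<phi> \<one> = UNIV"
      using x times_in_ideal[of "\<zero>"]
      by (auto simp: \<phi>_def times_commute[of "\<one>"] times_commute[of "\<zero>"])
    have "B \<in> Pow {False, True}" unfolding UNIV_bool[symmetric] by simp
    then have "B \<in> {{}, {True}, {False}, UNIV}" by (auto simp: Pow_insert UNIV_bool)
    then show ?thesis using \<phi> x by (metis (no_types) image_eqI insertE neg_closed one_closed
          singletonD zero_closed)
  qed
  ultimately show ?thesis unfolding quot_iso_B4_iff by (intro exI[of _ \<phi>]) auto
qed

section \<open>Putting the cases together\<close>

lemma middle_element:
  assumes "infinite (carrier (A /\<^sub>m\<^sub>v I)) \<or> card (carrier (A /\<^sub>m\<^sub>v I)) \<ge> 3"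
  obtains x where "x \<in> carrier A" "x \<notin> I" "\<sim> x \<notin> I"
proof (rule ccontr)
  note witness = that
  assume "\<not> thesis"
  then have all: "z \<in> I \<or> \<sim> z \<in> I" if "z \<in> carrier A" for z
    using that witness by blast
  \<comment> \<open>If one of \<open>z\<close>, \<open>\<sim> z\<close> is always in
    \<open>I\<close>, these two classes exhaust the quotient, which contradicts its size.\<close>
  let ?T = "{mv_cong A I `` {\<zero>}, mv_cong A I `` {\<one>}}"
  have "mv_cong A I `` {z} \<in> ?T" if z: "z \<in> carrier A" for z
    using all[OF z] z similar_neg_if_neg_in_ideal[of z] below_zero_iff[of z]
    by (auto simp: class_eq_iff)
  then have "carrier (A /\<^sub>m\<^sub>v I) \<subseteq> ?T" by (auto simp: quot_carrier)
  then have "finite (carrier (A /\<^sub>m\<^sub>v I))" "card (carrier (A /\<^sub>m\<^sub>v I)) \<le> card ?T"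
    by (auto intro: finite_subset card_mono)
  moreover have "card ?T \<le> 2" by (simp add: card_insert_if)
  ultimately show False using assms by simp
qed

lemma girth_otherwise:
  assumes "I \<noteq> {\<zero>}"
    and "infinite (carrier (A /\<^sub>m\<^sub>v I)) \<or> card (carrier (A /\<^sub>m\<^sub>v I)) \<ge> 3"
    and no_iso: "\<not> (\<exists>h \<in> mv_iso A (mv_chain 2 \<times>\<^sub>m\<^sub>v mv_chain 3).
      h ` I = carrier (mv_chain 2) \<times> {mv_zero (mv_chain 3)})"
    and no_B4: "\<not> A /\<^sub>m\<^sub>v I \<cong>\<^sub>m\<^sub>v mv_B4"
  shows "girth (ideal_graph I A) = 3"
proof (cases "\<exists>x \<in> carrier A - I. x \<odot> x \<in> I")
  case True
  then obtain x where x: "x \<in> carrier A" "x \<notin> I" "x \<odot> x \<in> I" by blast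
  have nx: "\<sim> x \<notin> I" using x in_ideal_if_neg_in_ideal_times by blast
  show ?thesis
  proof (cases "\<exists>z \<in> carrier A - I. x \<odot> z \<in> I \<and> \<not> x \<approx> z")
    case True
    then show ?thesis using girth_nilpotent assms(1) x by blast
  next
    case False
    then have cover: "x \<approx> z" if "z \<in> carrier A" "z \<notin> I" "\<sim> z \<notin> I" for z
      using nilpotent_quotient_three[OF x _ that] by blast
    obtain x' where x': "x' \<in> carrier A" "x' \<noteq> x" "x \<approx> x'"
      using other_representative assms(1) x by metis
    \<comment> \<open>Were the class of \<open>x\<close> contained in \<open>{x, x'}\<close>,
      \<open>iso_L2_L3\<close> would produce the excluded isomorphism; so the class has a third
      element.\<close>
    obtain z where z: "z \<in> carrier A" "x \<approx> z" "z \<noteq> x" "z \<noteq> x'"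
      using iso_L2_L3[OF assms(1) x(1,2) nx, of x'] cover no_iso by blast
    have "x' \<notin> I" "z \<notin> I" using x x' z below_in_ideal by auto
    moreover have "x \<odot> x' \<in> I" "x' \<odot> z \<in> I" "z \<odot> x \<in> I"
      using times_in_ideal_mono[of x x x' x] times_in_ideal_mono[of x' x z x]
        times_in_ideal_mono[of z x x x] x x' z by auto
    ultimately show ?thesis using girth_triangle[of x x' z] x x' z by auto
  qed
next
  case False
  then have reduced: "z \<in> I" if "z \<in> carrier A" "z \<odot> z \<in> I" for z using that by blast
  obtain x where x: "x \<in> carrier A" "x \<notin> I" "\<sim> x \<notin> I"
    using middle_element assms(2) by blast
  \<comment> \<open>If every middle element were similar to \<open>x\<close> or
    \<open>\<sim> x\<close>, the quotient would be \<open>mv_B4\<close>.\<close>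
  then obtain y where "y \<in> carrier A" "y \<notin> I" "\<sim> y \<notin> I" "\<not> x \<approx> y" "\<not> \<sim> x \<approx> y"
    using quot_iso_B4[of x] reduced no_B4 by blast
  then show ?thesis using girth_reduced[of x] reduced x by blast
qed

end

theorem theorem4p19:
  fixes A :: "('a, 'm) mv_scheme" and I :: "'a set"
  assumes "mv_algebra A"
    and "mv_proper_ideal I A"
    and "I \<noteq> {mv_zero A}"
    and "infinite (carrier (A /\<^sub>m\<^sub>v I)) \<or> card (carrier (A /\<^sub>m\<^sub>v I)) \<ge> 3"
  shows "((\<exists>h \<in> mv_iso A (mv_chain 2 \<times>\<^sub>m\<^sub>v mv_chain 3).
             h ` I = carrier (mv_chain 2) \<times> {mv_zero (mv_chain 3)})
           \<longrightarrow> girth (ideal_graph I A) = \<infinity>) \<and>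
         (A /\<^sub>m\<^sub>v I \<cong>\<^sub>m\<^sub>v mv_B4 \<longrightarrow> girth (ideal_graph I A) = 4) \<and>
         (\<not> (\<exists>h \<in> mv_iso A (mv_chain 2 \<times>\<^sub>m\<^sub>v mv_chain 3).
               h ` I = carrier (mv_chain 2) \<times> {mv_zero (mv_chain 3)}) \<and>
          \<not> (A /\<^sub>m\<^sub>v I \<cong>\<^sub>m\<^sub>v mv_B4)
           \<longrightarrow> girth (ideal_graph I A) = 3)"
proof -
  interpret mv_algebra_ideal A I
    using assms by (simp add: mv_algebra_ideal_def mv_algebra_ideal_axioms_def mv_proper_ideal_def)
  show ?thesis
    using girth_L2_L3 girth_B4 girth_otherwise assms(3,4) by blast
qed

end
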